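(* Let $A$ be a unital algebra over a field $F$ with $\operatorname{char}(F)\neq2$, and let $\mathcal{A}=M_n(A)$, $n\ge 2$, be the algebra of $n\times n$ matrices over $A$. Then $\operatorname{QJCent}(\mathcal{A})=\operatorname{Cent}(\mathcal{A})$.
   Context: $x\circ y=xy+yx$. $\operatorname{QJCent}(\mathcal{A})$: linear $f:\mathcal{A}\to\mathcal{A}$ with $f(x)\circ y=x\circ f(y)$ for all $x,y\in\mathcal{A}$. $\operatorname{Cent}(\mathcal{A})$: linear $f$ with $f(xy)=f(x)y=xf(y)$ for all $x,y$. *)

theory Defs
  imports "HOL-Analysis.Analysis"
begin

text \<open>A unital (associative) algebra over a field 'k: a type 'a of class ring_1
  together with a scalar multiplication making it a 'k-vector space, compatible
  with the ring multiplication.\<close>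
definition unital_algebra :: "('k::field \<Rightarrow> 'a::ring_1 \<Rightarrow> 'a) \<Rightarrow> bool" where
  "unital_algebra sc \<longleftrightarrow> vector_space sc \<and>
     (\<forall>c x y. sc c (x * y) = sc c x * y \<and> sc c (x * y) = x * sc c y)"

text \<open>Entrywise scalar multiplication on n x n matrices over 'a.\<close>
definition mat_scale :: "('k \<Rightarrow> 'a \<Rightarrow> 'a) \<Rightarrow> 'k \<Rightarrow> 'a^'n^'n \<Rightarrow> 'a^'n^'n" where
  "mat_scale sc c M = (\<chi> i j. sc c (M $ i $ j))"

text \<open>Jordan product x o y = xy + yx.\<close>
definition jordan :: "('b \<Rightarrow> 'b \<Rightarrow> 'b) \<Rightarrow> 'b \<Rightarrow> 'b \<Rightarrow> 'b::plus" where
  "jordan mul x y = mul x y + mul y x"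

definition QJCent :: "('k::field \<Rightarrow> 'b::ab_group_add \<Rightarrow> 'b) \<Rightarrow> ('b \<Rightarrow> 'b \<Rightarrow> 'b) \<Rightarrow> ('b \<Rightarrow> 'b) set" where
  "QJCent sc mul = {f. Vector_Spaces.linear sc sc f \<and>
      (\<forall>x y. jordan mul (f x) y = jordan mul x (f y))}"

definition Cent :: "('k::field \<Rightarrow> 'b::ab_group_add \<Rightarrow> 'b) \<Rightarrow> ('b \<Rightarrow> 'b \<Rightarrow> 'b) \<Rightarrow> ('b \<Rightarrow> 'b) set" where
  "Cent sc mul = {f. Vector_Spaces.linear sc sc f \<and>
      (\<forall>x y. f (mul x y) = mul (f x) y \<and> mul (f x) y = mul x (f y))}"

end

theory Submission
  imports Defs
begin

text \<open>Let \<open>f\<close> be quasi-Jordan-centralizing and \<open>c = f 1\<close>. Pairing with \<open>1\<close> gives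
  \<open>2 f(x) = xc + cx\<close>; substituting this back into \<open>f(x) \<circ> y = x \<circ> f(y)\<close> shows that \<open>c\<close>
  commutes with every commutator \<open>xy - yx\<close>. In \<open>M\<^sub>n(A)\<close> with \<open>n \<ge> 2\<close> every off-diagonal
  matrix unit \<open>E\<^sub>i\<^sub>j(a)\<close> is the commutator of \<open>E\<^sub>i\<^sub>i(a)\<close> and \<open>E\<^sub>i\<^sub>j(1)\<close>, and a matrix commuting with
  all of them is central. Hence \<open>2 f(x) = 2 xc\<close> with \<open>c\<close> central, and since \<open>2\<close> is
  invertible, \<open>f(x) = xc\<close>, which is a centralizer.\<close>

lemma Cent_subset_QJCent: "Cent sc mul \<subseteq> QJCent sc mul"
  unfolding Cent_def QJCent_def jordan_def by auto

lemma (in vector_space) double_cancel: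
  fixes x y :: 'b
  assumes "(2::'a) \<noteq> 0" and "x + x = y + y"
  shows "x = y"
proof -
  have half: "z = scale (1/2) (z + z)" for z
  proof -
    have "1/2 + 1/2 = (1::'a)" using assms(1) by (simp add: field_simps)
    then have "z = scale (1/2 + 1/2) z" by simp
    then show ?thesis by (simp only: scale_left_distrib scale_right_distrib)
  qed
  show ?thesis using half[of x] half[of y] assms(2) by simp
qed

lemma matrix_add_rdistrib: "((B::'a::semiring_1^'n^'m) + C) ** A = B ** A + C ** A"
  by (vector matrix_matrix_mult_def sum.distrib[symmetric] field_simps)

definition matrix_unit :: "'n \<Rightarrow> 'n \<Rightarrow> 'a::semiring_1 \<Rightarrow> 'a^'n^'n" where
  "matrix_unit i j a = (\<chi> p q. if p = i \<and> q = j then a else 0)"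

lemma matrix_mul_matrix_unit_component:
  "((c::'a::semiring_1^'n^'n) ** matrix_unit i j a) $ p $ q = (if q = j then c$p$i * a else 0)"
  by (simp add: matrix_matrix_mult_def matrix_unit_def if_distrib if_distribR sum.delta'
      cong: if_cong)

lemma matrix_unit_mul_matrix_component:
  "(matrix_unit i j a ** (c::'a::semiring_1^'n^'n)) $ p $ q = (if p = i then a * c$j$q else 0)"
  by (simp add: matrix_matrix_mult_def matrix_unit_def if_distrib if_distribR sum.delta'
      cong: if_cong)

lemma matrix_unit_mul_matrix_unit:
  "matrix_unit i j a ** matrix_unit k l b
     = (if j = k then matrix_unit i l (a * b) else (0::'a::semiring_1^'n^'n))"
  by (simp add: matrix_mul_matrix_unit_component vec_eq_iff) (auto simp: matrix_unit_def)

lemma exists_other_index: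
  fixes i :: "'n::finite"
  assumes "CARD('n) \<ge> 2"
  obtains j where "j \<noteq> i"
proof -
  have "UNIV \<noteq> {i}"
  proof
    assume "UNIV = {i}"
    then have "CARD('n) = card {i}" by (rule arg_cong)
    with assms show False by simp
  qed
  then show ?thesis using that by blast
qed

lemma scalar_central_matrix_commutes:
  fixes c :: "'a::ring_1^'n^'n"
  assumes off_diag: "\<And>p q. p \<noteq> q \<Longrightarrow> c$p$q = 0"
    and central: "\<And>p q a. c$p$p * a = a * c$q$q"
  shows "c ** M = M ** c"
proof -
  have "(c ** M) $ p $ q = c$p$p * M$p$q" for p q
  proof -
    have "(c ** M) $ p $ q = (\<Sum>k\<in>UNIV. c$p$k * M$k$q)"
      by (simp add: matrix_matrix_mult_def)
    also have "\<dots> = (\<Sum>k\<in>UNIV. if k = p then c$p$p * M$p$q else 0)"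
      by (rule sum.cong) (auto simp: off_diag)
    finally show ?thesis by simp
  qed
  moreover have "(M ** c) $ p $ q = M$p$q * c$q$q" for p q
  proof -
    have "(M ** c) $ p $ q = (\<Sum>k\<in>UNIV. M$p$k * c$k$q)"
      by (simp add: matrix_matrix_mult_def)
    also have "\<dots> = (\<Sum>k\<in>UNIV. if k = q then M$p$q * c$q$q else 0)"
      by (rule sum.cong) (auto simp: off_diag)
    finally show ?thesis by simp
  qed
  ultimately show ?thesis by (simp add: vec_eq_iff central)
qed

lemma central_if_commutes_with_matrix_units:
  fixes c :: "'a::ring_1^'n^'n"
  assumes card: "CARD('n) \<ge> 2"
    and comm: "\<And>i j a. i \<noteq> j \<Longrightarrow> c ** matrix_unit i j a = matrix_unit i j a ** c"
  shows "c ** M = M ** c"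
proof (rule scalar_central_matrix_commutes)
  have entries: "(if q = j then c$p$i * a else 0) = (if p = i then a * c$j$q else 0)"
    if "i \<noteq> j" for i j p q a
    using arg_cong[OF comm[OF that, of a], of "\<lambda>M. M $ p $ q"]
    by (simp add: matrix_mul_matrix_unit_component matrix_unit_mul_matrix_component)
  show "c$p$i = 0" if "p \<noteq> i" for p i
  proof -
    obtain j where "i \<noteq> j" using exists_other_index[OF card] by metis
    from entries[OF this, where p = p and q = j and a = 1] that show ?thesis by simp
  qed
  have diag: "c$i$i * a = a * c$j$j" if "i \<noteq> j" for i j a
    using entries[OF that, where p = i and q = j and a = a] by simp
  have diag_eq: "c$i$i = c$j$j" for i j
    using diag[of i j 1] by (cases "i = j") auto
  show "c$p$p * a = a * c$q$q" for p q a
  proof -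
    obtain k where "k \<noteq> p" using exists_other_index[OF card] .
    then show ?thesis using diag[of p k a] diag_eq[of k q] by simp
  qed
qed

context
  fixes f :: "'a::ring_1^'n^'n \<Rightarrow> 'a^'n^'n"
  assumes jordan_sym: "\<And>x y. jordan (**) (f x) y = jordan (**) x (f y)"
begin

lemma jordan_symmetric_double: "f x + f x = x ** f (mat 1) + f (mat 1) ** x"
  using jordan_sym[of x "mat 1"] by (simp add: jordan_def)

lemma jordan_symmetric_commutes_with_commutators:
  defines "c \<equiv> f (mat 1)"
  shows "c ** (x ** y) + (y ** x) ** c = (x ** y) ** c + c ** (y ** x)"
proof -
  have "(f x + f x) ** y + y ** (f x + f x) = x ** (f y + f y) + (f y + f y) ** x"
    using jordan_sym[of x y]
    by (simp add: jordan_def matrix_add_rdistrib matrix_add_ldistrib algebra_simps)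
  then have "(x ** c + c ** x) ** y + y ** (x ** c + c ** x)
      = x ** (y ** c + c ** y) + (y ** c + c ** y) ** x"
    by (simp add: jordan_symmetric_double c_def)
  then show ?thesis
    by (simp add: matrix_add_rdistrib matrix_add_ldistrib matrix_mul_assoc algebra_simps)
qed

lemma jordan_symmetric_unit_central:
  assumes "CARD('n) \<ge> 2"
  shows "f (mat 1) ** M = M ** f (mat 1)"
proof (rule central_if_commutes_with_matrix_units[OF assms])
  fix i j :: 'n and a :: 'a
  assume "i \<noteq> j"
  then show "f (mat 1) ** matrix_unit i j a = matrix_unit i j a ** f (mat 1)"
    using jordan_symmetric_commutes_with_commutators[of "matrix_unit i i a" "matrix_unit i j 1"]
    by (simp add: matrix_unit_mul_matrix_unit)
qed

lemma jordan_symmetric_eq_mult_unit: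
  fixes sc :: "'k::field \<Rightarrow> 'a \<Rightarrow> 'a"
  assumes "vector_space sc" and "(2::'k) \<noteq> 0" and "CARD('n) \<ge> 2"
  shows "f x = x ** f (mat 1)"
proof -
  have "f x + f x = x ** f (mat 1) + x ** f (mat 1)"
    using jordan_symmetric_double jordan_symmetric_unit_central[OF assms(3)] by simp
  then show ?thesis
    using vector_space.double_cancel[OF assms(1,2)] by (metis vec_eq_iff vector_add_component)
qed

end

lemma mult_central_in_Cent:
  fixes f :: "'a::ring_1^'n^'n \<Rightarrow> 'a^'n^'n"
  assumes "Vector_Spaces.linear sc sc f"
    and "\<And>x. f x = x ** c" and "\<And>M. c ** M = M ** c"
  shows "f \<in> Cent sc (**)"
  unfolding Cent_def using assms by (simp add: matrix_mul_assoc[symmetric])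

theorem proposition3p4:
  fixes sc :: "'k::field \<Rightarrow> 'a::ring_1 \<Rightarrow> 'a"
  assumes "unital_algebra sc"
    and "(2::'k) \<noteq> 0"
    and "CARD('n::finite) \<ge> 2"
  shows "QJCent (mat_scale sc :: 'k \<Rightarrow> 'a^'n^'n \<Rightarrow> 'a^'n^'n) (**)
         = Cent (mat_scale sc :: 'k \<Rightarrow> 'a^'n^'n \<Rightarrow> 'a^'n^'n) (**)"
proof
  show "QJCent (mat_scale sc :: 'k \<Rightarrow> 'a^'n^'n \<Rightarrow> 'a^'n^'n) (**) \<subseteq> Cent (mat_scale sc) (**)"
  proof
    fix f :: "'a^'n^'n \<Rightarrow> 'a^'n^'n"
    assume "f \<in> QJCent (mat_scale sc) (**)"
    then have lin: "Vector_Spaces.linear (mat_scale sc) (mat_scale sc) f"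
      and jordan_sym: "\<And>x y. jordan (**) (f x) y = jordan (**) x (f y)"
      unfolding QJCent_def by auto
    have "vector_space sc" using assms(1) unfolding unital_algebra_def by blast
    with jordan_sym assms(2,3) show "f \<in> Cent (mat_scale sc) (**)"
      by (intro mult_central_in_Cent[OF lin, where c = "f (mat 1)"]
          jordan_symmetric_eq_mult_unit jordan_symmetric_unit_central)
  qed
qed (rule Cent_subset_QJCent)

end
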